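(* Let $k, d \in \mathbb{N}$. Every digraph $D$ with $\delta^+(D) > (d+2)(k-1)$ and directed tree-width at most $d$ contains $k$ pairwise vertex-disjoint directed cycles of pairwise distinct lengths.
   Context: $\mathbb{N}$ denotes the positive integers. Digraphs are finite (and non-empty), have no loops and no parallel arcs, but may contain anti-parallel pairs of arcs (digons, which count as directed cycles of length $2$). $\delta^+(D)$ is the minimum out-degree of $D$. Directed tree-width. An out-arborescence $T$ is a directed rooted tree with all arcs directed away from the root. For $r,r'\in V(T)$ write $r\le r'$ if $r'$ is reachable from $r$ in $T$ (possibly $r=r'$); for an arc $e\in A(T)$ with head $r$, write $e<r'$ if $r\le r'$. For a digraph $D$ and $Z\subseteq V(D)$, a set $S\subseteq V(D)\setminus Z$ is $Z$-normal if the vertex set of every directed walk in $D-Z$ which starts and ends in $S$ is contained in $S$. A directed tree-decomposition of $D$ is a triple $(T,\beta,\gamma)$ where $T$ is an out-arborescence and $\beta:V(T)\to 2^{V(D)}$, $\gamma:A(T)\to 2^{V(D)}$ are functions such that (i) $\{\beta(t)\mid t\in V(T)\}$ is a partition of $V(D)$ into non-empty sets (one for each $t$), and (ii) for every $e\in A(T)$ the set $\bigcup\{\beta(t)\mid t\in V(T), e<t\}$ is $\gamma(e)$-normal. For $t\in V(T)$ let $\Gamma(t):=\beta(t)\cup\bigcup\{\gamma(e)\mid e\in A(T),\ e \text{ incident with } t\}$. The width of $(T,\beta,\gamma)$ is $\max_{t\in V(T)}|\Gamma(t)|-1$. The directed tree-width $\mathrm{dtw}(D)$ is the smallest width of a directed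 tree-decomposition of $D$. *)

theory Defs
  imports "Graph_Theory.Graph_Theory" "HOL-Library.Disjoint_Sets"
begin

definition min_out_degree :: "('a, 'b) pre_digraph \<Rightarrow> nat" where
  "min_out_degree G = Min (out_degree G ` verts G)"

definition out_arborescence :: "('t, 'e) pre_digraph \<Rightarrow> bool" where
  "out_arborescence T \<longleftrightarrow> wf_digraph T \<and>
    (\<exists>r\<in>verts T. \<forall>v\<in>verts T. \<exists>!p. pre_digraph.awalk T r p v)"

text \<open>A walk is a list of arcs, and the trivial walk at a vertex is allowed.\<close>

definition normal_set :: "('a, 'b) pre_digraph \<Rightarrow> 'a set \<Rightarrow> 'a set \<Rightarrow> bool" where
  "normal_set G Z S \<longleftrightarrow> S \<subseteq> verts G - Z \<and>
    (\<forall>u\<in>S. \<forall>v\<in>S. \<forall>p. pre_digraph.awalk (G \<restriction> (verts G - Z)) u p v \<longrightarrow>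
       set (pre_digraph.awalk_verts (G \<restriction> (verts G - Z)) u p) \<subseteq> S)"

text \<open>
  The tree vertices \<open>t\<close> with \<open>e < t\<close> are those reachable from the head of \<open>e\<close>.
  The injectivity of the bag function \<open>\<beta>\<close> expresses that the bags at distinct
  tree vertices are distinct (hence disjoint) blocks of the partition.
\<close>

definition directed_tree_decomposition ::
  "('a, 'b) pre_digraph \<Rightarrow> ('t, 'e) pre_digraph \<Rightarrow> ('t \<Rightarrow> 'a set) \<Rightarrow> ('e \<Rightarrow> 'a set) \<Rightarrow> bool"
where
  "directed_tree_decomposition G T \<beta> \<gamma> \<longleftrightarrow>
    out_arborescence T \<and>
    partition_on (verts G) (\<beta> ` verts T) \<and> inj_on \<beta> (verts T) \<and>
    (\<forall>e\<in>arcs T. \<gamma> e \<subseteq> verts G \<and>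
       normal_set G (\<gamma> e) (\<Union>t\<in>{t \<in> verts T. head T e \<rightarrow>\<^sup>*\<^bsub>T\<^esub> t}. \<beta> t))"

definition dtd_Gamma ::
  "('t, 'e) pre_digraph \<Rightarrow> ('t \<Rightarrow> 'a set) \<Rightarrow> ('e \<Rightarrow> 'a set) \<Rightarrow> 't \<Rightarrow> 'a set"
where
  "dtd_Gamma T \<beta> \<gamma> t = \<beta> t \<union> (\<Union>e\<in>{e \<in> arcs T. tail T e = t \<or> head T e = t}. \<gamma> e)"

definition dtd_width ::
  "('t, 'e) pre_digraph \<Rightarrow> ('t \<Rightarrow> 'a set) \<Rightarrow> ('e \<Rightarrow> 'a set) \<Rightarrow> nat"
where
  "dtd_width T \<beta> \<gamma> = Max ((\<lambda>t. card (dtd_Gamma T \<beta> \<gamma> t)) ` verts T) - 1"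

text \<open>
  Trees with vertices and arcs in \<^typ>\<open>nat\<close> suffice, as the tree of a decomposition of a finite
  digraph is finite; see \<open>directed_tree_width_le\<close> below. For a finite non-empty digraph the
  minimum is attained, see \<open>directed_tree_width_attained\<close>.
\<close>

definition directed_tree_width :: "('a, 'b) pre_digraph \<Rightarrow> nat" where
  "directed_tree_width G = (LEAST w. \<exists>(T :: (nat, nat) pre_digraph) \<beta> \<gamma>.
     directed_tree_decomposition G T \<beta> \<gamma> \<and> dtd_width T \<beta> \<gamma> = w)"

lemma directed_tree_decomposition_finite:
  assumes "directed_tree_decomposition G T \<beta> \<gamma>" and "finite (verts G)"
  shows "finite (verts T)" and "finite (arcs T)"
proof -
  have part: "partition_on (verts G) (\<beta> ` verts T)" and inj: "inj_on \<beta> (verts T)"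
    and arb: "out_arborescence T"
    using assms(1) by (auto simp: directed_tree_decomposition_def)
  have "\<beta> ` verts T \<subseteq> Pow (verts G)"
    using part by (auto simp: partition_on_def)
  then have "finite (\<beta> ` verts T)"
    using assms(2) by (meson finite_Pow_iff finite_subset)
  then show fin: "finite (verts T)"
    using inj by (rule finite_imageD)
  from arb obtain r where wf: "wf_digraph T" and r: "r \<in> verts T"
    and uniq: "\<And>v. v \<in> verts T \<Longrightarrow> \<exists>!p. pre_digraph.awalk T r p v"
    unfolding out_arborescence_def by blast
  interpret T: wf_digraph T by (rule wf)
  have "inj_on (arc_to_ends T) (arcs T)"
  proof (rule inj_onI)
    fix e e' assume e: "e \<in> arcs T" "e' \<in> arcs T" "arc_to_ends T e = arc_to_ends T e'"
    obtain p where p: "T.awalk r p (tail T e)"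
      using uniq[of "tail T e"] e by auto
    have "T.awalk r (p @ [e]) (head T e)" "T.awalk r (p @ [e']) (head T e)"
      using p e by (auto simp: arc_to_ends_def T.awalk_simps)
    then have "p @ [e] = p @ [e']"
      using uniq[of "head T e"] T.head_in_verts[OF e(1)] by blast
    then show "e = e'" by simp
  qed
  moreover have "arc_to_ends T ` arcs T \<subseteq> verts T \<times> verts T"
    by (auto simp: arc_to_ends_def)
  then have "finite (arc_to_ends T ` arcs T)"
    using fin by (meson finite_SigmaI finite_subset)
  ultimately show "finite (arcs T)"
    by (rule finite_imageD[rotated])
qed

lemma directed_tree_decomposition_nat:
  fixes T :: "('t, 'e) pre_digraph"
  assumes dtd: "directed_tree_decomposition G T \<beta> \<gamma>" and "finite (verts G)"
  obtains T' :: "(nat, nat) pre_digraph" and \<beta>' \<gamma>' where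
    "directed_tree_decomposition G T' \<beta>' \<gamma>'" and "dtd_width T' \<beta>' \<gamma>' = dtd_width T \<beta> \<gamma>"
proof -
  have part: "partition_on (verts G) (\<beta> ` verts T)" and inj: "inj_on \<beta> (verts T)"
    and arb: "out_arborescence T"
    and norm: "\<And>e. e \<in> arcs T \<Longrightarrow> \<gamma> e \<subseteq> verts G \<and>
       normal_set G (\<gamma> e) (\<Union>t\<in>{t \<in> verts T. head T e \<rightarrow>\<^sup>*\<^bsub>T\<^esub> t}. \<beta> t)"
    using dtd unfolding directed_tree_decomposition_def by blast+
  from arb obtain r where wf: "wf_digraph T" and r: "r \<in> verts T"
    and uniq: "\<And>v. v \<in> verts T \<Longrightarrow> \<exists>!p. pre_digraph.awalk T r p v"
    unfolding out_arborescence_def by blast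
  interpret T: wf_digraph T by (rule wf)
  obtain f :: "'t \<Rightarrow> nat" where f: "inj_on f (verts T)"
    using finite_imp_inj_to_nat_seg[OF directed_tree_decomposition_finite(1)[OF assms]]
    by metis
  obtain g :: "'e \<Rightarrow> nat" where g: "inj_on g (arcs T)"
    using finite_imp_inj_to_nat_seg[OF directed_tree_decomposition_finite(2)[OF assms]]
    by metis
  define h where "h = \<lparr>iso_verts = f, iso_arcs = g,
    iso_head = f \<circ> head T \<circ> the_inv_into (arcs T) g,
    iso_tail = f \<circ> tail T \<circ> the_inv_into (arcs T) g\<rparr>"
  have h: "T.digraph_isomorphism h"
    using f g wf by (auto simp: T.digraph_isomorphism_def h_def the_inv_into_f_f)
  define T' where "T' = app_iso h T"
  define \<beta>' where "\<beta>' = \<beta> \<circ> the_inv_into (verts T) f"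
  define \<gamma>' where "\<gamma>' = \<gamma> \<circ> the_inv_into (arcs T) g"
  interpret T': wf_digraph T'
    unfolding T'_def using h by (rule T.wf_digraphI_app_iso)
  have verts': "verts T' = f ` verts T" and arcs': "arcs T' = g ` arcs T"
    by (auto simp: T'_def h_def)
  have \<beta>': "\<beta>' (f t) = \<beta> t" if "t \<in> verts T" for t
    using that f by (simp add: \<beta>'_def the_inv_into_f_f)
  have \<gamma>': "\<gamma>' (g e) = \<gamma> e" if "e \<in> arcs T" for e
    using that g by (simp add: \<gamma>'_def the_inv_into_f_f)
  have ends: "head T' (g e) = f (head T e)" "tail T' (g e) = f (tail T e)"
    if "e \<in> arcs T" for e
    using that g by (simp_all add: T'_def h_def the_inv_into_f_f)
  have reach: "f s \<rightarrow>\<^sup>*\<^bsub>T'\<^esub> f t \<longleftrightarrow> s \<rightarrow>\<^sup>*\<^bsub>T\<^esub> t" if "s \<in> verts T" "t \<in> verts T" for s t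
    using T.reachable_app_iso_eq[OF h, of "f s" "f t"] that T.iso_verts_inv_iso[OF h, of s]
      T.iso_verts_inv_iso[OF h, of t]
    by (simp add: T'_def h_def)
  have arb': "out_arborescence T'"
    unfolding out_arborescence_def
  proof (intro conjI bexI ballI)
    show "wf_digraph T'" by (rule T'.wf_digraph)
    show "f r \<in> verts T'" using r verts' by auto
  next
    fix v' assume "v' \<in> verts T'"
    then obtain v where v: "v \<in> verts T" "v' = f v" by (auto simp: verts')
    obtain p where p: "T.awalk r p v" and pu: "\<And>q. T.awalk r q v \<Longrightarrow> q = p"
      using uniq[OF v(1)] by blast
    show "\<exists>!p. T'.awalk (f r) p v'"
    proof (rule ex1I)
      show "T'.awalk (f r) (map g p) v'"
        using T.awalk_app_isoI[OF p h] by (simp add: T'_def h_def v)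
    next
      fix q assume q: "T'.awalk (f r) q v'"
      have sub: "set q \<subseteq> g ` arcs T" using q by (simp add: T'.awalk_def arcs')
      have "T.awalk r (map (iso_arcs (T.inv_iso h)) q) v"
        using T.awalk_app_isoD[OF q[unfolded T'_def] h] T.iso_verts_inv_iso[OF h r]
          T.iso_verts_inv_iso[OF h v(1)]
        by (simp add: v h_def)
      then have "map (iso_arcs (T.inv_iso h)) q = p" by (rule pu)
      then have "map g p = map (\<lambda>x. g (the_inv_into (arcs T) g x)) q"
        by (auto simp: T.inv_iso_def h_def)
      also have "\<dots> = q"
        using sub g by (intro map_idI) (auto simp: the_inv_into_f_f)
      finally show "q = map g p" by simp
    qed
  qed
  have img: "\<beta>' ` verts T' = \<beta> ` verts T"
    by (auto simp: verts' \<beta>' image_image)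
  have inj': "inj_on \<beta>' (verts T')"
    using inj by (auto simp: verts' inj_on_def \<beta>')
  have norm': "\<gamma>' e' \<subseteq> verts G \<and>
      normal_set G (\<gamma>' e') (\<Union>t\<in>{t \<in> verts T'. head T' e' \<rightarrow>\<^sup>*\<^bsub>T'\<^esub> t}. \<beta>' t)"
    if e': "e' \<in> arcs T'" for e'
  proof -
    obtain e where e: "e \<in> arcs T" "e' = g e" using e' by (auto simp: arcs')
    have "{t \<in> verts T'. head T' e' \<rightarrow>\<^sup>*\<^bsub>T'\<^esub> t} = f ` {t \<in> verts T. head T e \<rightarrow>\<^sup>*\<^bsub>T\<^esub> t}"
      using e by (auto simp: verts' ends reach)
    then have "(\<Union>t\<in>{t \<in> verts T'. head T' e' \<rightarrow>\<^sup>*\<^bsub>T'\<^esub> t}. \<beta>' t)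
        = (\<Union>t\<in>{t \<in> verts T. head T e \<rightarrow>\<^sup>*\<^bsub>T\<^esub> t}. \<beta> t)"
      by (auto simp: \<beta>')
    then show ?thesis using norm[OF e(1)] e by (simp add: \<gamma>')
  qed
  have Gamma: "dtd_Gamma T' \<beta>' \<gamma>' (f t) = dtd_Gamma T \<beta> \<gamma> t" if t: "t \<in> verts T" for t
  proof -
    have "{e \<in> arcs T'. tail T' e = f t \<or> head T' e = f t}
        = g ` {e \<in> arcs T. tail T e = t \<or> head T e = t}"
      using t by (auto simp: arcs' ends inj_on_eq_iff[OF f])
    then show ?thesis
      using t by (auto simp: dtd_Gamma_def \<beta>' \<gamma>')
  qed
  have "directed_tree_decomposition G T' \<beta>' \<gamma>'"
    using arb' part inj' norm' by (simp add: directed_tree_decomposition_def img)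
  moreover have "(\<lambda>t. card (dtd_Gamma T' \<beta>' \<gamma>' t)) ` verts T'
      = (\<lambda>t. card (dtd_Gamma T \<beta> \<gamma> t)) ` verts T"
    by (simp add: verts' image_image Gamma cong: image_cong_simp)
  then have "dtd_width T' \<beta>' \<gamma>' = dtd_width T \<beta> \<gamma>"
    by (simp add: dtd_width_def)
  ultimately show ?thesis by (rule that)
qed

lemma directed_tree_width_le:
  fixes T :: "('t, 'e) pre_digraph"
  assumes "directed_tree_decomposition G T \<beta> \<gamma>" and "finite (verts G)"
  shows "directed_tree_width G \<le> dtd_width T \<beta> \<gamma>"
  using directed_tree_decomposition_nat[OF assms]
  unfolding directed_tree_width_def by (metis (mono_tags, lifting) Least_le)

lemma directed_tree_width_attained:
  assumes "finite (verts G)" and "verts G \<noteq> {}"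
  obtains T :: "(nat, nat) pre_digraph" and \<beta> \<gamma> where
    "directed_tree_decomposition G T \<beta> \<gamma>" and "dtd_width T \<beta> \<gamma> = directed_tree_width G"
proof -
  define T :: "(nat, nat) pre_digraph"
    where "T = \<lparr>verts = {0}, arcs = {}, tail = id, head = id\<rparr>"
  interpret T: wf_digraph T by unfold_locales (auto simp: T_def)
  have "T.awalk 0 p 0 \<longleftrightarrow> p = []" for p
    unfolding T.awalk_def by (auto simp: T_def pre_digraph.cas.simps)
  then have "out_arborescence T"
    using T.wf_digraph by (auto simp: out_arborescence_def T_def)
  then have "directed_tree_decomposition G T (\<lambda>_. verts G) (\<lambda>_. {})"
    using assms(2) by (auto simp: directed_tree_decomposition_def T_def partition_on_space)
  then have "\<exists>w (T :: (nat, nat) pre_digraph) \<beta> \<gamma>.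
      directed_tree_decomposition G T \<beta> \<gamma> \<and> dtd_width T \<beta> \<gamma> = w"
    by blast
  from LeastI_ex[OF this] show ?thesis
    using that unfolding directed_tree_width_def by blast
qed

end

theory Submission
  imports Defs
begin

text \<open>
  Induction on \<open>k\<close>, for induced subdigraphs on \<open>X \<subseteq> V(D)\<close> and a fixed decomposition of \<open>D\<close>.
  Let \<open>t\<close> be a lowest tree vertex such that the part \<open>S\<close> of \<open>D\<close> at or below \<open>t\<close> contains a
  subdigraph \<open>Y \<subseteq> X\<close> of minimum out-degree at least \<open>k\<close>. The end of a longest path in \<open>Y\<close> has
  all its out-neighbours in \<open>Y\<close> on the path, so \<open>Y\<close> has cycles of \<open>k\<close> different lengths. Let
  \<open>K\<close> be a terminal strong component of \<open>X - \<Gamma>(t)\<close>. Deleting \<open>\<Gamma>(t)\<close> costs at most \<open>d + 1\<close> in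
  out-degree, so for \<open>k \<ge> 2\<close> the component \<open>K\<close> has minimum out-degree at least \<open>k\<close>. By normality it
  either avoids \<open>S\<close> or lies below a child of \<open>t\<close>, and the latter contradicts the choice of \<open>t\<close>.
  By induction \<open>K\<close> has \<open>k - 1\<close> disjoint cycles of distinct lengths, and some cycle in \<open>Y\<close> has
  a length different from all of these.
\<close>

section \<open>Cycles, minimum out-degree and terminal strong components\<close>

text \<open>Cycles are lists of vertices, so that a suffix of a path closed by one arc is directly a
  cycle; the arc lists of the final statement are recovered in
  \<open>list_cycle_arcs_endsE\<close>.\<close>

definition list_cycle :: "('a \<times> 'a) set \<Rightarrow> 'a list \<Rightarrow> bool" where
  "list_cycle E xs \<longleftrightarrow> xs \<noteq> [] \<and> distinct xs \<and> successively (\<lambda>x y. (x, y) \<in> E) xs \<and>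
     (last xs, hd xs) \<in> E"

text \<open>\<open>X\<close> stands for the subdigraph it induces, so the induction varies a vertex
  set while the arc relation stays fixed.\<close>

definition min_out_ge :: "('a \<times> 'a) set \<Rightarrow> nat \<Rightarrow> 'a set \<Rightarrow> bool" where
  "min_out_ge E m X \<longleftrightarrow> X \<noteq> {} \<and> (\<forall>v\<in>X. m \<le> card (E `` {v} \<inter> X))"

definition strong_in :: "('a \<times> 'a) set \<Rightarrow> 'a set \<Rightarrow> bool" where
  "strong_in E K \<longleftrightarrow> (\<forall>u\<in>K. \<forall>v\<in>K. (u, v) \<in> (E \<inter> K \<times> K)\<^sup>*)"

lemma min_out_ge_mono: "min_out_ge E m X \<Longrightarrow> n \<le> m \<Longrightarrow> min_out_ge E n X"
  by (auto simp: min_out_ge_def)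

lemma min_out_ge_Diff:
  assumes "min_out_ge E (m + c) X" "finite X" "finite Z" "card Z \<le> c" "0 < m"
  shows "min_out_ge E m (X - Z)"
proof -
  \<comment> \<open>This covers the vertices of \<open>Z\<close> too. Hence any vertex of
    \<open>X\<close> has an out-neighbour in \<open>X - Z\<close> when \<open>0 < m\<close>, and
    \<open>X - Z\<close> is non-empty.\<close>
  have deg: "m \<le> card (E `` {v} \<inter> (X - Z))" if "v \<in> X" for v
  proof -
    have "m + c \<le> card (E `` {v} \<inter> X)"
      using assms(1) that by (simp add: min_out_ge_def)
    moreover have "card (E `` {v} \<inter> X) - card Z \<le> card (E `` {v} \<inter> X - Z)"
      by (rule diff_card_le_card_Diff[OF assms(3)])
    moreover have "E `` {v} \<inter> X - Z = E `` {v} \<inter> (X - Z)" by blast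
    ultimately show ?thesis using assms(4) by simp
  qed
  obtain v where "v \<in> X" using assms(1) by (auto simp: min_out_ge_def)
  with deg assms(5) have "X - Z \<noteq> {}" by fastforce
  with deg show ?thesis by (simp add: min_out_ge_def)
qed

text \<open>Among the sets reachable inside \<open>X\<close> from a single vertex, take one of least
  size. It is closed under arcs within \<open>X\<close>, so out-degrees are kept, and by minimality
  each of its vertices reaches all of it.\<close>

lemma terminal_strong_component:
  assumes "finite X" "min_out_ge E m X"
  obtains K where "K \<subseteq> X" "min_out_ge E m K" "strong_in E K"
proof -
  define R where "R v = (E \<inter> X \<times> X)\<^sup>* `` {v}" for v
  have RX: "R v \<subseteq> X" if "v \<in> X" for v
    using that by (auto simp: R_def elim: rtranclE)
  obtain x where "x \<in> X" using assms(2) by (auto simp: min_out_ge_def)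
  then obtain v where v: "v \<in> X" and v_min: "\<And>w. w \<in> X \<Longrightarrow> card (R v) \<le> card (R w)"
    using ex_has_least_nat[of "\<lambda>v. v \<in> X" x "\<lambda>v. card (R v)"] by blast
  have fin: "finite (R v)" using RX[OF v] assms(1) finite_subset by blast
  have R_eq: "R w = R v" if w: "w \<in> R v" for w
  proof (rule card_seteq[OF fin])
    show "R w \<subseteq> R v" using w by (auto simp: R_def)
    show "card (R v) \<le> card (R w)" using v_min RX[OF v] w by blast
  qed
  have closed: "y \<in> R v" if "x \<in> R v" "(x, y) \<in> E" "y \<in> X" for x y
    using that RX[OF v] by (auto simp: R_def intro: rtrancl_into_rtrancl)
  have vR: "v \<in> R v" by (simp add: R_def)
  have "E `` {x} \<inter> R v = E `` {x} \<inter> X" if "x \<in> R v" for x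
    using that closed RX[OF v] by auto
  then have "min_out_ge E m (R v)"
    using assms(2) RX[OF v] vR by (auto simp: min_out_ge_def)
  moreover have "strong_in E (R v)"
    unfolding strong_in_def
  proof (intro ballI)
    fix x y assume x: "x \<in> R v" and "y \<in> R v"
    then have "(x, y) \<in> (E \<inter> X \<times> X)\<^sup>*" using R_eq by (auto simp: R_def)
    \<comment> \<open>A walk in \<open>X\<close> that starts in \<open>R v\<close> never leaves
      \<open>R v\<close>.\<close>
    then show "(x, y) \<in> (E \<inter> R v \<times> R v)\<^sup>*"
    proof (induction rule: rtrancl_induct)
      case (step y z)
      have "y \<in> R v" "z \<in> R v"
        using x step.hyps by (auto simp: R_def intro: rtrancl_trans rtrancl_into_rtrancl)
      with step show ?case by (auto intro: rtrancl_into_rtrancl)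
    qed simp
  qed
  ultimately show ?thesis using that RX[OF v] by blast
qed

section \<open>Cycles of many lengths from a longest path\<close>

lemma list_cycle_avoiding_lengths:
  assumes "finite Y" "min_out_ge E m Y" "finite F" "card F < m"
  obtains xs where "list_cycle E xs" "set xs \<subseteq> Y" "length xs \<notin> F"
proof -
  let ?P = "\<lambda>xs. xs \<noteq> [] \<and> distinct xs \<and> set xs \<subseteq> Y \<and> successively (\<lambda>x y. (x, y) \<in> E) xs"
  obtain y where "y \<in> Y" using assms(2) by (auto simp: min_out_ge_def)
  then have "?P [y]" by simp
  moreover have "\<forall>xs. ?P xs \<longrightarrow> length xs < Suc (card Y)"
    using assms(1) by (metis card_mono distinct_card less_Suc_eq_le)
  ultimately obtain xs where xs: "?P xs" and longest: "\<And>ys. ?P ys \<Longrightarrow> length ys \<le> length xs"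
    using ex_has_greatest_nat[of ?P "[y]" length "Suc (card Y)"] by blast
  define N where "N = E `` {last xs} \<inter> Y"
  have N_sub: "N \<subseteq> set xs"
  proof
    fix z assume z: "z \<in> N"
    show "z \<in> set xs"
    proof (rule ccontr)
      assume "z \<notin> set xs"
      then have "?P (xs @ [z])"
        using xs z by (auto simp: N_def successively_append_iff)
      from longest[OF this] show False by simp
    qed
  qed
  \<comment> \<open>Closing the path from its end back to position \<open>i\<close> gives the cycle
    \<open>drop i xs\<close> of length \<open>length xs - i\<close>. Different positions give
    different lengths, so at least \<open>m\<close> lengths occur and one of them is outside
    \<open>F\<close>.\<close>
  define I where "I = {i. i < length xs \<and> xs ! i \<in> N}"
  have "N = (\<lambda>i. xs ! i) ` I"
    using N_sub by (auto simp: I_def in_set_conv_nth subset_iff)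
  moreover have "finite I" by (simp add: I_def)
  ultimately have "card N \<le> card I" using card_image_le by blast
  moreover have "m \<le> card N"
    using assms(2) xs last_in_set[of xs] unfolding min_out_ge_def N_def by blast
  moreover have "card ((\<lambda>i. length xs - i) ` I) = card I"
    by (rule card_image) (auto simp: inj_on_def I_def)
  ultimately have "card F < card ((\<lambda>i. length xs - i) ` I)"
    using assms(4) by linarith
  then have "\<not> (\<lambda>i. length xs - i) ` I \<subseteq> F"
    using card_mono[OF assms(3)] by (meson leD)
  then obtain i where i: "i < length xs" "xs ! i \<in> N" "length xs - i \<notin> F"
    by (auto simp: I_def)
  have "successively (\<lambda>x y. (x, y) \<in> E) (take i xs @ drop i xs)" using xs by simp
  then have "successively (\<lambda>x y. (x, y) \<in> E) (drop i xs)"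
    by (simp only: successively_append_iff)
  then have "list_cycle E (drop i xs)"
    using xs i by (auto simp: list_cycle_def N_def hd_drop_conv_nth)
  with i xs show ?thesis
    by (intro that[of "drop i xs"]) (auto dest: in_set_dropD)
qed

section \<open>From vertex lists to arc walks\<close>

lemma (in wf_digraph) successively_arcs_ends_awalk:
  assumes "xs \<noteq> []" "set xs \<subseteq> verts G" "successively (\<lambda>x y. (x, y) \<in> arcs_ends G) xs"
  shows "\<exists>p. awalk (hd xs) p (last xs) \<and> awalk_verts (hd xs) p = xs"
  using assms
proof (induction xs rule: list_nonempty_induct)
  case (single x)
  then show ?case by (intro exI[of _ "[]"]) (simp add: awalk_Nil_iff)
next
  case (cons x xs)
  then obtain p where p: "awalk (hd xs) p (last xs)" "awalk_verts (hd xs) p = xs"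
    by (auto simp: successively_Cons)
  from cons obtain e where "e \<in> arcs G" "tail G e = x" "head G e = hd xs"
    by (auto simp: successively_Cons arcs_ends_conv)
  with p cons.hyps show ?case
    by (intro exI[of _ "e # p"]) (auto simp: awalk_Cons_iff)
qed

lemma (in wf_digraph) list_cycle_arcs_endsE:
  assumes "list_cycle (arcs_ends G) xs"
  obtains c where "cycle c" "tail G ` set c = set xs" "length c = length xs"
proof -
  from assms have xs: "xs \<noteq> []" "distinct xs" "successively (\<lambda>x y. (x, y) \<in> arcs_ends G) xs"
      "(last xs, hd xs) \<in> arcs_ends G"
    by (auto simp: list_cycle_def)
  obtain e where e: "e \<in> arcs G" "tail G e = last xs" "head G e = hd xs"
    using xs(4) by (auto simp: arcs_ends_conv)
  have "last xs \<in> verts G" using tail_in_verts[OF e(1)] e by simp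
  \<comment> \<open>Every vertex but the last is the tail of an arc along the list; the last one is
    the tail of the closing arc \<open>e\<close>.\<close>
  with xs(1,3) have "set xs \<subseteq> verts G"
  proof (induction xs rule: list_nonempty_induct)
    case (cons x xs)
    then have "set xs \<subseteq> verts G" "x \<in> verts G"
      by (auto simp: successively_Cons arcs_ends_conv)
    then show ?case by simp
  qed simp
  from successively_arcs_ends_awalk[OF xs(1) this xs(3)] obtain p
    where p: "awalk (hd xs) p (last xs)" "awalk_verts (hd xs) p = xs" by blast
  have walk: "awalk (hd xs) (p @ [e]) (hd xs)"
    using p(1) e head_in_verts[OF e(1)] by (simp add: awalk_simps)
  have tails: "map (tail G) (p @ [e]) = xs"
    using p e by (auto simp: awalk_verts_conv split: if_splits)
  then have "awalk_verts (hd xs) (p @ [e]) = xs @ [hd xs]"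
    using e by (simp add: awalk_verts_conv)
  with walk xs(1,2) have "cycle (p @ [e])"
    unfolding cycle_def by (cases xs) auto
  moreover have "tail G ` set (p @ [e]) = set xs"
    using tails by (metis set_map)
  moreover have "length (p @ [e]) = length xs"
    using tails by (metis length_map)
  ultimately show ?thesis by (rule that)
qed

section \<open>Strongly connected sets and normality\<close>

lemma (in wf_digraph) rtrancl_awalk_induce:
  assumes "(u, v) \<in> (arcs_ends G \<inter> X \<times> X)\<^sup>*" "u \<in> X" "X \<subseteq> verts G"
  shows "\<exists>p. pre_digraph.awalk (G \<restriction> X) u p v"
proof -
  interpret H: wf_digraph "G \<restriction> X" by (rule wellformed_induce_subgraph)
  from assms(1) have "u \<rightarrow>\<^sup>*\<^bsub>G \<restriction> X\<^esub> v"
  proof (induction rule: rtrancl_induct)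
    case base
    then show ?case using assms by (intro H.reachable_refl) auto
  next
    case (step y z)
    then have "y \<rightarrow>\<^bsub>G \<restriction> X\<^esub> z" by (auto simp: arcs_ends_conv)
    with step.IH show ?case by (rule H.reachable_adj_trans)
  qed
  then show ?thesis by (simp add: H.reachable_awalk)
qed

text \<open>From a vertex of \<open>K \<inter> S\<close> there is a closed walk through any other
  vertex of \<open>K\<close> that avoids \<open>Z\<close>; normality keeps this walk inside
  \<open>S\<close>.\<close>

lemma normal_set_strong_in:
  assumes "wf_digraph G" "normal_set G Z S" "strong_in (arcs_ends G) K"
    and "K \<subseteq> verts G - Z" "K \<inter> S \<noteq> {}"
  shows "K \<subseteq> S"
proof
  fix w assume w: "w \<in> K"
  interpret wf_digraph G by (rule assms(1))
  let ?V = "verts G - Z"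
  interpret H: wf_digraph "G \<restriction> ?V" by (rule wellformed_induce_subgraph)
  obtain s where s: "s \<in> K" "s \<in> S" using assms(5) by blast
  have "(u, v) \<in> (arcs_ends G \<inter> ?V \<times> ?V)\<^sup>*" if "u \<in> K" "v \<in> K" for u v
    using assms(3) that rtrancl_mono[of "arcs_ends G \<inter> K \<times> K" "arcs_ends G \<inter> ?V \<times> ?V"] assms(4)
    unfolding strong_in_def by blast
  then have "\<exists>p. H.awalk u p v" if "u \<in> K" "v \<in> K" for u v
    using that assms(4) by (intro rtrancl_awalk_induce) auto
  then obtain p q where pq: "H.awalk s p w" "H.awalk w q s"
    using s w by meson
  then have pq_walk: "H.awalk s (p @ q) s" by simp
  have "w \<in> set (H.awalk_verts s (p @ q))"
    using pq_walk pq by (auto simp: H.set_awalk_verts_append)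
  with assms(2) s pq_walk show "w \<in> S"
    unfolding normal_set_def by blast
qed

section \<open>Descending in the tree of a decomposition\<close>

text \<open>At \<open>t = head T e\<close> this is the set required to be
  \<open>\<gamma> e\<close>-normal.\<close>

definition dtd_below :: "('t, 'e) pre_digraph \<Rightarrow> ('t \<Rightarrow> 'a set) \<Rightarrow> 't \<Rightarrow> 'a set" where
  "dtd_below T \<beta> t = (\<Union>s\<in>{s \<in> verts T. t \<rightarrow>\<^sup>*\<^bsub>T\<^esub> s}. \<beta> s)"

context
  fixes T :: "('t, 'e) pre_digraph"
  assumes arb: "out_arborescence T"
begin

interpretation T: wf_digraph T
  using arb by (simp add: out_arborescence_def)

text \<open>A walk back to the tail would give a second walk from the root to that tail.\<close>

lemma out_arborescence_no_return:
  assumes "e \<in> arcs T"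
  shows "\<not> head T e \<rightarrow>\<^sup>*\<^bsub>T\<^esub> tail T e"
proof
  assume "head T e \<rightarrow>\<^sup>*\<^bsub>T\<^esub> tail T e"
  then obtain q where q: "T.awalk (head T e) q (tail T e)" by (auto simp: T.reachable_awalk)
  obtain r where "\<forall>v\<in>verts T. \<exists>!p. T.awalk r p v"
    using arb by (auto simp: out_arborescence_def)
  then obtain p where p: "T.awalk r p (tail T e)" and
      pu: "\<And>p'. T.awalk r p' (tail T e) \<Longrightarrow> p' = p"
    using T.tail_in_verts[OF assms] by blast
  have "T.awalk r (p @ e # q) (tail T e)"
    using p q assms by (simp add: T.awalk_simps)
  from pu[OF this] show False by simp
qed

text \<open>Splits the walks down from \<open>t\<close> by their first arc, so that a set meeting
  the part below \<open>t\<close> but not the bag of \<open>t\<close> meets the part below a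
  child.\<close>

lemma dtd_below_step:
  assumes "t \<in> verts T"
  shows "dtd_below T \<beta> t = \<beta> t \<union> (\<Union>e\<in>{e \<in> arcs T. tail T e = t}. dtd_below T \<beta> (head T e))"
    (is "?l = ?r")
proof
  show "?l \<subseteq> ?r"
  proof
    fix x assume "x \<in> ?l"
    then obtain s where s: "s \<in> verts T" "t \<rightarrow>\<^sup>*\<^bsub>T\<^esub> s" "x \<in> \<beta> s" by (auto simp: dtd_below_def)
    from s(2) obtain p where p: "T.awalk t p s" by (auto simp: T.reachable_awalk)
    show "x \<in> ?r"
    proof (cases p)
      case Nil
      with p s show ?thesis by (simp add: T.awalk_Nil_iff)
    next
      case (Cons e q)
      with p have e: "e \<in> arcs T" "tail T e = t" "T.awalk (head T e) q s"
        by (auto simp: T.awalk_Cons_iff)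
      then have "head T e \<rightarrow>\<^sup>*\<^bsub>T\<^esub> s" by (auto simp: T.reachable_awalk)
      with e s show ?thesis by (auto simp: dtd_below_def)
    qed
  qed
  show "?r \<subseteq> ?l"
    using assms by (auto simp: dtd_below_def intro: T.adj_reachable_trans T.in_arcs_imp_in_arcs_ends)
qed

lemma out_arborescence_root:
  obtains r where "r \<in> verts T" "\<And>v. v \<in> verts T \<Longrightarrow> r \<rightarrow>\<^sup>*\<^bsub>T\<^esub> v"
  using arb that unfolding out_arborescence_def by (metis T.reachable_awalk)

end

text \<open>Here \<open>S\<close> is the part below a lowest \<open>t\<close> satisfying
  \<open>P\<close>, \<open>Z\<close> is \<Gamma>(t), and \<open>S'\<close> is the part below a child
  of \<open>t\<close>. A strong \<open>K\<close> outside \<open>Z\<close> avoids the bag of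
  \<open>t\<close>, and the sets \<open>\<gamma> e\<close> of the arcs to the children lie in
  \<open>Z\<close>, so normality traps \<open>K\<close> below one child as soon as it meets
  \<open>S\<close>.\<close>

lemma dtd_lowest_separator:
  assumes dtd: "directed_tree_decomposition G T \<beta> \<gamma>" and wf: "wf_digraph G"
    and fin: "finite (verts G)" and P: "P (verts G)"
  obtains S Z where "P S" "Z \<subseteq> verts G" "card Z \<le> dtd_width T \<beta> \<gamma> + 1"
    and "\<forall>K \<subseteq> verts G - Z. strong_in (arcs_ends G) K \<longrightarrow>
      K \<inter> S = {} \<or> (\<exists>S'. \<not> P S' \<and> K \<subseteq> S')"
proof -
  let ?S = "dtd_below T \<beta>"
  have arb: "out_arborescence T" and part: "partition_on (verts G) (\<beta> ` verts T)"
    and inj: "inj_on \<beta> (verts T)"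
    and norm: "\<And>e. e \<in> arcs T \<Longrightarrow> \<gamma> e \<subseteq> verts G"
      "\<And>e. e \<in> arcs T \<Longrightarrow> normal_set G (\<gamma> e) (?S (head T e))"
    using dtd unfolding directed_tree_decomposition_def dtd_below_def by blast+
  interpret T: wf_digraph T
    using arb by (simp add: out_arborescence_def)
  obtain r where r: "r \<in> verts T" "\<And>v. v \<in> verts T \<Longrightarrow> r \<rightarrow>\<^sup>*\<^bsub>T\<^esub> v"
    using out_arborescence_root[OF arb] by blast
  have un: "\<Union> (\<beta> ` verts T) = verts G" and ne: "\<And>t. t \<in> verts T \<Longrightarrow> \<beta> t \<noteq> {}"
    using part by (auto simp: partition_on_def)
  have disj: "\<beta> s \<inter> \<beta> t = {}" if "s \<in> verts T" "t \<in> verts T" "s \<noteq> t" for s t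
    using part that inj by (auto simp: partition_on_def disjoint_def inj_on_eq_iff)
  have root: "?S r = verts G" using un r by (auto simp: dtd_below_def)
  have S_sub: "?S t \<subseteq> verts G" for t using un by (auto simp: dtd_below_def)
  \<comment> \<open>Lowest means least cardinality of \<open>?S t\<close>. Passing to a child makes
    this set strictly smaller, as the non-empty bag of \<open>t\<close> is lost.\<close>
  obtain t where t: "t \<in> verts T" "P (?S t)"
    and t_min: "\<And>s. s \<in> verts T \<Longrightarrow> P (?S s) \<Longrightarrow> card (?S t) \<le> card (?S s)"
    using ex_has_least_nat[of "\<lambda>t. t \<in> verts T \<and> P (?S t)" r "\<lambda>t. card (?S t)"] P r root
    by auto
  have child: "\<not> P (?S (head T e))" if e: "e \<in> arcs T" "tail T e = t" for e
  proof
    assume "P (?S (head T e))"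
    then have le: "card (?S t) \<le> card (?S (head T e))" using t_min e by simp
    have "?S (head T e) \<subseteq> ?S t"
      using dtd_below_step[OF arb t(1), of \<beta>] e by auto
    then have "?S (head T e) = ?S t"
      using card_seteq[OF finite_subset[OF S_sub fin] _ le] by blast
    moreover have "\<beta> t \<subseteq> ?S t" using dtd_below_step[OF arb t(1), of \<beta>] by auto
    moreover have "\<beta> t \<inter> ?S (head T e) = {}"
    proof -
      have "\<beta> t \<inter> \<beta> s = {}" if s: "s \<in> verts T" "head T e \<rightarrow>\<^sup>*\<^bsub>T\<^esub> s" for s
        using disj[OF t(1) s(1)] s(2) out_arborescence_no_return[OF arb e(1)] e(2) by metis
      then show ?thesis by (auto simp: dtd_below_def)
    qed
    ultimately show False using ne[OF t(1)] by blast
  qed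
  let ?Z = "dtd_Gamma T \<beta> \<gamma> t"
  have "card ?Z \<le> Max ((\<lambda>t. card (dtd_Gamma T \<beta> \<gamma> t)) ` verts T)"
    using t(1) directed_tree_decomposition_finite(1)[OF dtd fin] by (intro Max_ge) auto
  \<comment> \<open>The subtraction in \<open>dtd_width\<close> is truncated, which is harmless for
    this inequality.\<close>
  then have "card ?Z \<le> dtd_width T \<beta> \<gamma> + 1" by (simp add: dtd_width_def)
  moreover have "?Z \<subseteq> verts G"
    using norm(1) un t(1) by (auto simp: dtd_Gamma_def)
  moreover have "K \<inter> ?S t = {} \<or> (\<exists>S'. \<not> P S' \<and> K \<subseteq> S')"
    if K: "K \<subseteq> verts G - ?Z" "strong_in (arcs_ends G) K" for K
  proof (cases "K \<inter> ?S t = {}")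
    case meets: False
    have away: "K \<subseteq> verts G - \<gamma> e" if "e \<in> arcs T" "tail T e = t" for e
      using K(1) that by (auto simp: dtd_Gamma_def)
    have "K \<inter> \<beta> t = {}" using K(1) by (auto simp: dtd_Gamma_def)
    with meets obtain e where e: "e \<in> arcs T" "tail T e = t" "K \<inter> ?S (head T e) \<noteq> {}"
      unfolding dtd_below_step[OF arb t(1)] by blast
    then have "K \<subseteq> ?S (head T e)"
      using normal_set_strong_in[OF wf norm(2) K(2) away] by blast
    with child e show ?thesis by blast
  qed simp
  ultimately show ?thesis by (intro that[OF t(2)]) auto
qed

section \<open>The induction and the theorem\<close>

text \<open>The index is shifted: \<open>k\<close> here yields the \<open>k + 1\<close> cycles
  \<open>c 0\<close>, ..., \<open>c k\<close>. The decomposition of \<open>G\<close> is never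
  restricted to \<open>X\<close>.\<close>

lemma disjoint_list_cycles:
  assumes dtd: "directed_tree_decomposition G T \<beta> \<gamma>" and wf: "wf_digraph G"
    and fin: "finite (verts G)" and width: "dtd_width T \<beta> \<gamma> \<le> d"
    and "X \<subseteq> verts G" and "min_out_ge (arcs_ends G) ((d + 2) * k + 1) X"
  shows "\<exists>c. (\<forall>i\<le>k. list_cycle (arcs_ends G) (c i) \<and> set (c i) \<subseteq> X) \<and>
    (\<forall>i\<le>k. \<forall>j\<le>k. i \<noteq> j \<longrightarrow> set (c i) \<inter> set (c j) = {} \<and> length (c i) \<noteq> length (c j))"
  using assms(5,6)
proof (induction k arbitrary: X)
  case 0
  have "finite X" using 0(1) fin by (rule finite_subset)
  from list_cycle_avoiding_lengths[OF this 0(2), of "{}"] obtain xs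
    where "list_cycle (arcs_ends G) xs" "set xs \<subseteq> X" by auto
  then show ?case by (intro exI[of _ "\<lambda>_. xs"]) auto
next
  case (Suc k)
  let ?E = "arcs_ends G"
  \<comment> \<open>The threshold \<open>k + 2\<close> exceeds the number \<open>k + 1\<close> of
    lengths that the new cycle has to avoid.\<close>
  define P where "P S \<longleftrightarrow> (\<exists>Y \<subseteq> S \<inter> X. min_out_ge ?E (k + 2) Y)" for S
  have finX: "finite X" using Suc.prems(1) fin by (rule finite_subset)
  have "1 * k \<le> (d + 2) * k" by (rule mult_le_mono1) simp
  then have deg: "k + 2 \<le> (d + 2) * k + 2" "k + 2 \<le> (d + 2) * Suc k + 1"
    by auto
  have P_verts: "P (verts G)"
    using Suc.prems(1) min_out_ge_mono[OF Suc.prems(2) deg(2)] unfolding P_def by blast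
  obtain S Z where S: "P S" and Z: "Z \<subseteq> verts G" "card Z \<le> dtd_width T \<beta> \<gamma> + 1"
    and sep: "\<forall>K \<subseteq> verts G - Z. strong_in ?E K \<longrightarrow>
      K \<inter> S = {} \<or> (\<exists>S'. \<not> P S' \<and> K \<subseteq> S')"
    by (rule dtd_lowest_separator[where P = P, OF dtd wf fin P_verts])
  \<comment> \<open>Of the \<open>d + 2\<close> gained per step, \<open>d + 1\<close> pays for
    deleting \<open>Z\<close>. The remaining one gives \<open>K\<close> out-degree at least
    \<open>k + 2\<close> even for \<open>k = 0\<close>.\<close>
  have "min_out_ge ?E (((d + 2) * k + 2) + (d + 1)) X"
    using Suc.prems(2) by (simp add: algebra_simps)
  moreover have "card Z \<le> d + 1" using Z(2) width by linarith
  ultimately have "min_out_ge ?E ((d + 2) * k + 2) (X - Z)"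
    by (rule min_out_ge_Diff[OF _ finX finite_subset[OF Z(1) fin]]) simp
  then obtain K where K: "K \<subseteq> X - Z" "min_out_ge ?E ((d + 2) * k + 2) K" "strong_in ?E K"
    using terminal_strong_component[of "X - Z"] finX by blast
  \<comment> \<open>\<open>K\<close> itself witnesses \<open>P\<close> for every superset, so it
    cannot lie in a set failing \<open>P\<close> and must avoid \<open>S\<close>.\<close>
  have "P S'" if "K \<subseteq> S'" for S'
    using that K(1) min_out_ge_mono[OF K(2) deg(1)] unfolding P_def by blast
  moreover have "K \<subseteq> verts G - Z" using K(1) Suc.prems(1) by blast
  ultimately have KS: "K \<inter> S = {}" using sep K(3) by blast
  have "K \<subseteq> verts G" "min_out_ge ?E ((d + 2) * k + 1) K"
    using K Suc.prems(1) min_out_ge_mono[OF K(2)] by auto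
  from Suc.IH[OF this] obtain c where
    c: "\<And>i. i \<le> k \<Longrightarrow> list_cycle ?E (c i)" "\<And>i. i \<le> k \<Longrightarrow> set (c i) \<subseteq> K"
      "\<And>i j. i \<le> k \<Longrightarrow> j \<le> k \<Longrightarrow> i \<noteq> j \<Longrightarrow>
        set (c i) \<inter> set (c j) = {} \<and> length (c i) \<noteq> length (c j)"
    by blast
  from S obtain Y where Y: "Y \<subseteq> S" "Y \<subseteq> X" "min_out_ge ?E (k + 2) Y"
    unfolding P_def by blast
  have "card ((\<lambda>i. length (c i)) ` {..k}) < k + 2"
    using card_image_le[of "{..k}" "\<lambda>i. length (c i)"] by simp
  with list_cycle_avoiding_lengths[OF finite_subset[OF Y(2) finX] Y(3),
      of "(\<lambda>i. length (c i)) ` {..k}"]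
  obtain xs where xs: "list_cycle ?E xs" "set xs \<subseteq> Y"
      "length xs \<notin> (\<lambda>i. length (c i)) ` {..k}"
    by blast
  have new: "set (c i) \<inter> set xs = {} \<and> length (c i) \<noteq> length xs" if "i \<le> k" for i
  proof
    show "set (c i) \<inter> set xs = {}" using c(2)[OF that] xs(2) Y(1) KS by blast
    show "length (c i) \<noteq> length xs" using xs(3) that by (metis atMost_iff image_eqI)
  qed
  show ?case
  proof (intro exI[of _ "c(Suc k := xs)"] conjI allI impI)
    fix i assume "i \<le> Suc k"
    then show "list_cycle ?E ((c(Suc k := xs)) i)"
      using c(1) xs(1) by (auto simp: le_Suc_eq)
    show "set ((c(Suc k := xs)) i) \<subseteq> X"
    proof (cases "i = Suc k")
      case True
      then show ?thesis using xs(2) Y(2) by auto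
    next
      case False
      with \<open>i \<le> Suc k\<close> have "set (c i) \<subseteq> K" by (intro c(2)) simp
      with False K(1) show ?thesis by auto
    qed
  next
    fix i j assume "i \<le> Suc k" "j \<le> Suc k" "i \<noteq> j"
    then show "set ((c(Suc k := xs)) i) \<inter> set ((c(Suc k := xs)) j) = {}"
      using c(3) new by (auto simp: le_Suc_eq)
    show "length ((c(Suc k := xs)) i) \<noteq> length ((c(Suc k := xs)) j)"
      using \<open>i \<le> Suc k\<close> \<open>j \<le> Suc k\<close> \<open>i \<noteq> j\<close> c(3)[of i j] new[of i] new[of j]
      by (auto simp: le_Suc_eq)
  qed
qed

lemma (in digraph) min_out_ge_verts:
  assumes "verts G \<noteq> {}" "m \<le> min_out_degree G"
  shows "min_out_ge (arcs_ends G) m (verts G)"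
proof -
  have "m \<le> card (arcs_ends G `` {v} \<inter> verts G)" if v: "v \<in> verts G" for v
  proof -
    have "m \<le> out_degree G v"
      using assms(2) Min_le[OF finite_imageI[OF finite_verts] imageI[OF v], of "out_degree G"]
      unfolding min_out_degree_def by (rule order_trans)
    \<comment> \<open>Without parallel arcs, counting out-arcs is counting out-neighbours.\<close>
    also have "\<dots> = card (head G ` out_arcs G v)"
      unfolding out_degree_def
      by (rule card_image[symmetric])
        (auto simp: inj_on_def arc_to_ends_def intro: no_multi_arcs)
    also have "head G ` out_arcs G v = arcs_ends G `` {v} \<inter> verts G"
      by (auto simp: arcs_ends_conv)
    finally show ?thesis .
  qed
  with assms(1) show ?thesis by (simp add: min_out_ge_def)
qed

theorem proposition6:
  fixes D :: "('a, 'b) pre_digraph" and k d :: nat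
  assumes "digraph D" and "verts D \<noteq> {}"
    and "k \<ge> 1" and "d \<ge> 1"
    and "min_out_degree D > (d + 2) * (k - 1)"
    and "directed_tree_width D \<le> d"
  shows "\<exists>c :: nat \<Rightarrow> 'b awalk.
    (\<forall>i<k. pre_digraph.cycle D (c i)) \<and>
    (\<forall>i<k. \<forall>j<k. i \<noteq> j \<longrightarrow>
       tail D ` set (c i) \<inter> tail D ` set (c j) = {} \<and> length (c i) \<noteq> length (c j))"
proof -
  interpret digraph D by fact
  obtain T :: "(nat, nat) pre_digraph" and \<beta> \<gamma> where
    dtd: "directed_tree_decomposition D T \<beta> \<gamma>" "dtd_width T \<beta> \<gamma> = directed_tree_width D"
    using directed_tree_width_attained[OF finite_verts assms(2)] by blast
  have "min_out_ge (arcs_ends D) ((d + 2) * (k - 1) + 1) (verts D)"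
    using assms(2,5) by (intro min_out_ge_verts) auto
  moreover have "dtd_width T \<beta> \<gamma> \<le> d" using dtd(2) assms(6) by simp
  \<comment> \<open>Since \<open>k \<ge> 1\<close>, the indices up to \<open>k - 1\<close> are
    exactly those below \<open>k\<close>.\<close>
  ultimately have "\<exists>l. (\<forall>i\<le>k - 1. list_cycle (arcs_ends D) (l i) \<and> set (l i) \<subseteq> verts D) \<and>
      (\<forall>i\<le>k - 1. \<forall>j\<le>k - 1. i \<noteq> j \<longrightarrow>
        set (l i) \<inter> set (l j) = {} \<and> length (l i) \<noteq> length (l j))"
    using disjoint_list_cycles[OF dtd(1) wf_digraph finite_verts _ subset_refl] by blast
  then obtain l where l: "\<And>i. i \<le> k - 1 \<Longrightarrow> list_cycle (arcs_ends D) (l i)"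
      "\<And>i j. i \<le> k - 1 \<Longrightarrow> j \<le> k - 1 \<Longrightarrow> i \<noteq> j \<Longrightarrow>
        set (l i) \<inter> set (l j) = {} \<and> length (l i) \<noteq> length (l j)"
    by blast
  have "\<exists>c. cycle c \<and> tail D ` set c = set (l i) \<and> length c = length (l i)" if "i \<le> k - 1" for i
    using list_cycle_arcs_endsE[OF l(1)[OF that]] by metis
  then obtain c where c: "\<And>i. i \<le> k - 1 \<Longrightarrow>
      cycle (c i) \<and> tail D ` set (c i) = set (l i) \<and> length (c i) = length (l i)"
    by metis
  show ?thesis
  proof (intro exI[of _ c] conjI allI impI)
    fix i assume "i < k"
    then show "cycle (c i)" using c[of i] by simp
  next
    fix i j assume "i < k" "j < k" "i \<noteq> j"
    then show "tail D ` set (c i) \<inter> tail D ` set (c j) = {}"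
      "length (c i) \<noteq> length (c j)"
      using c[of i] c[of j] l(2)[of i j] by auto
  qed
qed

end
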